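(* For each real number $a>0$, the parabolic segment $\mathcal{S}^p_a:=\{(x,y)\in\mathbb{R}^2:\ x-y^2\ge0,\ \sqrt{a}\,y\ge x\}$ is a $2$-brick.
   Context: $\overline{B}_m$ denotes the closed unit ball of $\mathbb{R}^m$ centered at the origin. An $n$-dimensional semialgebraic set $T\subset\mathbb{R}^n$ is an $m$-brick if there exists a homotopy $H=(H_1,\ldots,H_n):[0,1]\times\overline{B}_m\to T$ such that: (1) each $H_i$ is the restriction to $[0,1]\times\overline{B}_m$ of a polynomial of the ring $\mathcal{C}^0([0,1])[x_1,\ldots,x_m]$, where $\mathcal{C}^0([0,1])$ is the ring of continuous real functions on $[0,1]$; (2) $H(\{0\}\times\overline{B}_m)=T$ and $H(1,\cdot)$ is a constant map; (3) $H(\{t\}\times\overline{B}_m)\subset\operatorname{Int}(T)$ for each $t\in(0,1)$, where $\operatorname{Int}$ is the topological interior in $\mathbb{R}^n$. *)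

theory Defs
  imports "HOL-Analysis.Analysis" "HOL-Algebra.Ideal"
begin

text \<open>The smallest family of subsets that contains all sets \<open>{x. p x > 0}\<close> with \<open>p\<close> a real
  polynomial and is closed under finite unions, finite intersections and complements.\<close>

inductive semialgebraic :: "('a::euclidean_space) set \<Rightarrow> bool" where
  pos: "real_polynomial_function p \<Longrightarrow> semialgebraic {x. p x > 0}"
| Un: "semialgebraic A \<Longrightarrow> semialgebraic B \<Longrightarrow> semialgebraic (A \<union> B)"
| Int: "semialgebraic A \<Longrightarrow> semialgebraic B \<Longrightarrow> semialgebraic (A \<inter> B)"
| Compl: "semialgebraic A \<Longrightarrow> semialgebraic (- A)"

text \<open>The ring of polynomial functions on \<open>A\<close>, i.e. \<open>\<real>[x\<^sub>1,\<dots>,x\<^sub>n]\<close> modulo the ideal of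
  polynomials vanishing on \<open>A\<close>. Restricting to \<open>A\<close> (\<open>undefined\<close> outside) is what identifies
  polynomials that agree on \<open>A\<close>.\<close>

definition polynomial_ring_on :: "('a::euclidean_space) set \<Rightarrow> ('a \<Rightarrow> real) ring" where
  "polynomial_ring_on A =
    \<lparr> carrier = {restrict p A | p. real_polynomial_function p},
      mult = (\<lambda>f g. restrict (\<lambda>x. f x * g x) A),
      one = restrict (\<lambda>x. 1) A,
      zero = restrict (\<lambda>x. 0) A,
      add = (\<lambda>f g. restrict (\<lambda>x. f x + g x) A) \<rparr>"

text \<open>The supremum of the lengths of chains of prime ideals. The zero ring, which has no prime
  ideals, gets the value \<open>0\<close> here.\<close>

definition krull_dim :: "('a, 'b) ring_scheme \<Rightarrow> enat" where
  "krull_dim R = Sup {enat d | d. \<exists>P :: nat \<Rightarrow> 'a set.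
     (\<forall>i\<le>d. primeideal (P i) R) \<and> (\<forall>i<d. P i \<subset> P (Suc i))}"

text \<open>The dimension of a semialgebraic set in the sense of Bochnak, Coste and Roy.\<close>

definition semialgebraic_dim :: "('a::euclidean_space) set \<Rightarrow> enat" where
  "semialgebraic_dim A = krull_dim (polynomial_ring_on A)"

text \<open>\<open>h (t, x)\<close> is, for \<open>t \<in> [0,1]\<close> and \<open>x\<close> in the closed unit ball, the value at \<open>x\<close> of a
  polynomial with coefficients in \<open>C\<^sup>0([0,1])\<close>. The finite set \<open>M\<close> consists of exponent vectors
  \<open>\<alpha>\<close>, and \<open>c \<alpha>\<close> is the coefficient of \<open>x\<^sub>1^\<alpha>\<^sub>1 \<cdots> x\<^sub>m^\<alpha>\<^sub>m\<close>.\<close>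

definition polynomial_over_C0 :: "(real \<times> (real ^ 'm) \<Rightarrow> real) \<Rightarrow> bool" where
  "polynomial_over_C0 h \<longleftrightarrow>
    (\<exists>(M :: ('m \<Rightarrow> nat) set) (c :: ('m \<Rightarrow> nat) \<Rightarrow> real \<Rightarrow> real).
       finite M \<and> (\<forall>\<alpha>\<in>M. continuous_on {0..1} (c \<alpha>)) \<and>
       (\<forall>t\<in>{0..1}. \<forall>x\<in>cball 0 1.
          h (t, x) = (\<Sum>\<alpha>\<in>M. c \<alpha> t * (\<Prod>j\<in>UNIV. (x $ j) ^ \<alpha> j))))"

text \<open>The number \<open>m\<close> of an \<open>m\<close>-brick is \<open>CARD('m)\<close>, supplied as in \<open>brick TYPE(2) T\<close>. The
  requirement that \<open>T\<close> be an \<open>n\<close>-dimensional subset of \<open>\<real>\<^sup>n\<close> is part of the predicate.\<close>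

definition brick :: "'m::finite itself \<Rightarrow> (real ^ 'n) set \<Rightarrow> bool" where
  "brick _ T \<longleftrightarrow>
     semialgebraic T \<and> semialgebraic_dim T = enat CARD('n) \<and>
     (\<exists>H :: real \<times> (real ^ 'm) \<Rightarrow> real ^ 'n.
        continuous_on ({0..1} \<times> cball 0 1) H \<and>
        H ` ({0..1} \<times> cball 0 1) \<subseteq> T \<and>
        (\<forall>i. polynomial_over_C0 (\<lambda>z. H z $ i)) \<and>
        H ` ({0} \<times> cball 0 1) = T \<and>
        (\<lambda>x. H (1, x)) constant_on cball 0 1 \<and>
        (\<forall>t\<in>{0<..<1}. H ` ({t} \<times> cball 0 1) \<subseteq> interior T))"

definition parabolic_segment :: "real \<Rightarrow> (real ^ 2) set" where
  "parabolic_segment a = {v. v $ 1 - (v $ 2)\<^sup>2 \<ge> 0 \<and> sqrt a * v $ 2 \<ge> v $ 1}"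

end

theory Submission
  imports Defs
begin

text \<open>
  The region \<open>y\<^sup>2 \<le> x \<le> \<surd>a y\<close> is a polynomial image of the disc in a particularly direct way.
  Along each horizontal line put \<open>w = x - y\<^sup>2\<close>; the region becomes
  \<open>0 \<le> w \<le> \<surd>a y - y\<^sup>2\<close>, and with \<open>w = z\<^sup>2\<close> the upper bound reads
  \<open>z\<^sup>2 + (y - \<surd>a/2)\<^sup>2 \<le> a/4\<close>, which is a disc. After an affine change of coordinates this gives
  \<open>(u, v) \<mapsto> (a ((1 + u)\<^sup>2 + v\<^sup>2) / 4, \<surd>a (1 + u) / 2)\<close>, a map of the closed unit disc onto the
  segment (\<open>parabolic_segment_polynomial_image_of_disc\<close>).

  Since the segment is convex, the homotopy is then the straight-line contraction
  \<open>(1 - t) F(x) + t p\<close> to an interior point \<open>p\<close>: points of a convex set that are moved towards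
  an interior point become interior at once. This works for every convex semialgebraic set with
  nonempty interior that is a polynomial image of a ball (\<open>brick_convex_polynomial_image\<close>).

  The dimension of a brick is a Krull dimension, and the bulk of the text shows that the ring of
  polynomial functions on a convex set with nonempty interior in an \<open>n\<close>-dimensional space has
  Krull dimension \<open>n\<close>. For the lower bound, a flag of convex subsets of dimensions
  \<open>n, n - 1, \<dots>, 0\<close> has vanishing ideals that form a chain, and the vanishing ideal of a convex
  set is prime because two polynomials can be compared on a line segment, where a nonzero
  polynomial has finitely many zeros. For the upper bound, suppose that
  \<open>P\<^sub>0 \<subset> P\<^sub>1 \<subset> \<dots> \<subset> P\<^sub>m\<close> are primes with \<open>m > n\<close>, and choose \<open>f\<^sub>i \<in> P\<^sub>i\<^sub>+\<^sub>1 - P\<^sub>i\<close>. By counting monomials,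
  \<open>f\<^sub>0, \<dots>, f\<^sub>m\<^sub>-\<^sub>1\<close> satisfy a nontrivial polynomial relation. Starting from the lexicographically
  smallest monomial of the relation and cancelling factors outside the primes, one finds a nonzero
  constant in \<open>P\<^sub>m\<close> (\<open>polynomial_in_chain_elements_not_in_bottom\<close>), a contradiction.
\<close>

section \<open>Polynomials of bounded degree and algebraic dependence\<close>

definition monomial_fun :: "('a::euclidean_space \<Rightarrow> nat) \<Rightarrow> 'a \<Rightarrow> real" where
  "monomial_fun \<alpha> x = (\<Prod>b\<in>Basis. (x \<bullet> b) ^ \<alpha> b)"

text \<open>The bound is on each exponent separately and not on the total degree, so that the number of
  exponent vectors is a plain power. They are extensional, which makes the set finite.\<close>
definition exponents_upto :: "nat \<Rightarrow> ('a::euclidean_space \<Rightarrow> nat) set" where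
  "exponents_upto d = (Basis \<rightarrow>\<^sub>E {..d})"

definition polys_upto :: "nat \<Rightarrow> ('a::euclidean_space \<Rightarrow> real) set" where
  "polys_upto d = {p. \<exists>c. \<forall>x. p x = (\<Sum>\<alpha>\<in>exponents_upto d. c \<alpha> * monomial_fun \<alpha> x)}"

lemma finite_exponents_upto [simp]: "finite (exponents_upto d)"
  by (simp add: exponents_upto_def finite_PiE)

lemma card_exponents_upto:
  "card (exponents_upto d :: ('a::euclidean_space \<Rightarrow> nat) set) = Suc d ^ DIM('a)"
  by (simp add: exponents_upto_def card_PiE)

lemma polys_upto_add:
  assumes "p \<in> polys_upto d" "q \<in> polys_upto d"
  shows "(\<lambda>x. p x + q x) \<in> polys_upto d"
proof -
  obtain c c' where "\<forall>x. p x = (\<Sum>\<alpha>\<in>exponents_upto d. c \<alpha> * monomial_fun \<alpha> x)"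
    "\<forall>x. q x = (\<Sum>\<alpha>\<in>exponents_upto d. c' \<alpha> * monomial_fun \<alpha> x)"
    using assms by (auto simp: polys_upto_def)
  then have "\<forall>x. p x + q x = (\<Sum>\<alpha>\<in>exponents_upto d. (c \<alpha> + c' \<alpha>) * monomial_fun \<alpha> x)"
    by (simp add: sum.distrib distrib_right)
  then show ?thesis
    unfolding polys_upto_def by (intro CollectI exI[of _ "\<lambda>\<alpha>. c \<alpha> + c' \<alpha>"])
qed

lemma polys_upto_scale:
  assumes "p \<in> polys_upto d"
  shows "(\<lambda>x. r * p x) \<in> polys_upto d"
proof -
  obtain c where "\<forall>x. p x = (\<Sum>\<alpha>\<in>exponents_upto d. c \<alpha> * monomial_fun \<alpha> x)"
    using assms by (auto simp: polys_upto_def)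
  then have "\<forall>x. r * p x = (\<Sum>\<alpha>\<in>exponents_upto d. (r * c \<alpha>) * monomial_fun \<alpha> x)"
    by (simp add: sum_distrib_left mult.assoc)
  then show ?thesis
    unfolding polys_upto_def by (intro CollectI exI[of _ "\<lambda>\<alpha>. r * c \<alpha>"])
qed

lemma polys_upto_sum:
  assumes "\<And>i. i \<in> I \<Longrightarrow> p i \<in> polys_upto d"
  shows "(\<lambda>x. \<Sum>i\<in>I. p i x) \<in> polys_upto d"
proof (cases "finite I")
  case True
  then show ?thesis using assms
  proof (induction I)
    case empty
    have "\<forall>x. (0::real) = (\<Sum>\<alpha>\<in>exponents_upto d. 0 * monomial_fun \<alpha> x)" by simp
    then show ?case unfolding polys_upto_def sum.empty
      by (intro CollectI exI[of _ "\<lambda>_. 0"])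
  qed (simp add: polys_upto_add)
next
  case False
  have "\<forall>x. (0::real) = (\<Sum>\<alpha>\<in>exponents_upto d. 0 * monomial_fun \<alpha> x)" by simp
  then show ?thesis using False unfolding polys_upto_def
    by (auto intro: exI[of _ "\<lambda>_. 0"])
qed

lemma monomial_fun_in_polys_upto:
  assumes "\<alpha> \<in> exponents_upto d"
  shows "monomial_fun \<alpha> \<in> polys_upto d"
proof -
  have "\<forall>x. monomial_fun \<alpha> x
      = (\<Sum>\<beta>\<in>exponents_upto d. (if \<beta> = \<alpha> then 1 else 0) * monomial_fun \<beta> x)"
    using assms by (simp add: if_distrib[of "\<lambda>z. z * _"] cong: if_cong)
  then show ?thesis
    unfolding polys_upto_def by (intro CollectI exI[of _ "\<lambda>\<beta>. if \<beta> = \<alpha> then 1 else 0"])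
qed

lemma polys_upto_mono:
  assumes "p \<in> polys_upto d" "d \<le> e"
  shows "p \<in> polys_upto e"
proof -
  obtain c where c: "\<forall>x. p x = (\<Sum>\<alpha>\<in>exponents_upto d. c \<alpha> * monomial_fun \<alpha> x)"
    using assms(1) by (auto simp: polys_upto_def)
  have "\<alpha> \<in> exponents_upto e" if "\<alpha> \<in> exponents_upto d" for \<alpha> :: "'a \<Rightarrow> nat"
    using that assms(2) by (force simp: exponents_upto_def PiE_iff)
  then have "(\<lambda>x. \<Sum>\<alpha>\<in>exponents_upto d. c \<alpha> * monomial_fun \<alpha> x) \<in> polys_upto e"
    by (intro polys_upto_sum polys_upto_scale monomial_fun_in_polys_upto)
  moreover have "p = (\<lambda>x. \<Sum>\<alpha>\<in>exponents_upto d. c \<alpha> * monomial_fun \<alpha> x)"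
    using c by auto
  ultimately show ?thesis by simp
qed

lemma polys_upto_mult:
  assumes "p \<in> polys_upto d" "q \<in> polys_upto e"
  shows "(\<lambda>x. p x * q x) \<in> polys_upto (d + e)"
proof -
  obtain c where c: "\<And>x. p x = (\<Sum>\<alpha>\<in>exponents_upto d. c \<alpha> * monomial_fun \<alpha> x)"
    using assms(1) by (auto simp: polys_upto_def)
  obtain c' where c': "\<And>x. q x = (\<Sum>\<beta>\<in>exponents_upto e. c' \<beta> * monomial_fun \<beta> x)"
    using assms(2) by (auto simp: polys_upto_def)
  define s :: "('a \<Rightarrow> nat) \<Rightarrow> ('a \<Rightarrow> nat) \<Rightarrow> 'a \<Rightarrow> nat"
    where "s \<alpha> \<beta> = (\<lambda>b\<in>Basis. \<alpha> b + \<beta> b)" for \<alpha> \<beta>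
  have s_mono: "monomial_fun \<alpha> x * monomial_fun \<beta> x = monomial_fun (s \<alpha> \<beta>) x" for \<alpha> \<beta> x
    by (simp add: monomial_fun_def s_def power_add prod.distrib)
  have s_in: "s \<alpha> \<beta> \<in> exponents_upto (d + e)"
    if "\<alpha> \<in> exponents_upto d" "\<beta> \<in> exponents_upto e" for \<alpha> \<beta>
    using that by (auto simp: exponents_upto_def s_def PiE_iff intro!: add_mono)
  have "p x * q x = (\<Sum>\<alpha>\<in>exponents_upto d. \<Sum>\<beta>\<in>exponents_upto e.
      (c \<alpha> * c' \<beta>) * monomial_fun (s \<alpha> \<beta>) x)" for x
    unfolding c c' sum_product s_mono[symmetric] by (simp add: mult_ac)
  then have "(\<lambda>x. p x * q x) = (\<lambda>x. \<Sum>\<alpha>\<in>exponents_upto d. \<Sum>\<beta>\<in>exponents_upto e.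
      (c \<alpha> * c' \<beta>) * monomial_fun (s \<alpha> \<beta>) x)" by auto
  then show ?thesis
    using s_in by (auto intro!: polys_upto_sum polys_upto_scale monomial_fun_in_polys_upto)
qed

lemma polys_upto_const: "(\<lambda>x. r) \<in> polys_upto d"
proof -
  have "(\<lambda>b\<in>Basis. 0) \<in> (exponents_upto d :: ('a \<Rightarrow> nat) set)"
    by (auto simp: exponents_upto_def)
  from polys_upto_scale[OF monomial_fun_in_polys_upto[OF this], of r]
  show ?thesis by (simp add: monomial_fun_def)
qed

lemma polys_upto_power:
  assumes "p \<in> polys_upto d"
  shows "(\<lambda>x. p x ^ k) \<in> polys_upto (k * d)"
proof (induction k)
  case (Suc k)
  show ?case using polys_upto_mult[OF assms Suc] by simp
qed (simp add: polys_upto_const)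

lemma polys_upto_prod:
  assumes "finite I" "\<And>i. i \<in> I \<Longrightarrow> p i \<in> polys_upto d"
  shows "(\<lambda>x. \<Prod>i\<in>I. p i x) \<in> polys_upto (card I * d)"
  using assms
proof (induction I)
  case (insert i I)
  show ?case using polys_upto_mult[of "p i" d] insert by simp
qed (simp add: polys_upto_const)

lemma real_polynomial_function_imp_polys_upto:
  assumes "real_polynomial_function p"
  shows "\<exists>d. p \<in> polys_upto d"
  using assms
proof (induction p)
  case (linear f)
  interpret bounded_linear f by fact
  have coord: "(\<lambda>x. x \<bullet> b) \<in> polys_upto 1" if b: "b \<in> Basis" for b :: 'a
  proof -
    have "(\<lambda>b'\<in>Basis. if b' = b then 1 else 0) \<in> (exponents_upto 1 :: ('a \<Rightarrow> nat) set)"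
      by (auto simp: exponents_upto_def)
    moreover have "monomial_fun (\<lambda>b'\<in>Basis. if b' = b then 1 else 0) = (\<lambda>x::'a. x \<bullet> b)"
    proof
      fix x :: 'a
      have "monomial_fun (\<lambda>b'\<in>Basis. if b' = b then 1 else 0) x
          = (\<Prod>b'\<in>Basis. if b' = b then x \<bullet> b' else 1)"
        unfolding monomial_fun_def by (intro prod.cong) auto
      then show "monomial_fun (\<lambda>b'\<in>Basis. if b' = b then 1 else 0) x = x \<bullet> b"
        using b by simp
    qed
    ultimately show ?thesis by (metis monomial_fun_in_polys_upto)
  qed
  have "f x = (\<Sum>b\<in>Basis. f b * (x \<bullet> b))" for x
  proof -
    have "f x = f (\<Sum>b\<in>Basis. (x \<bullet> b) *\<^sub>R b)" by (simp add: euclidean_representation)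
    then show ?thesis by (simp add: sum scaleR mult.commute)
  qed
  then have "f = (\<lambda>x. \<Sum>b\<in>Basis. f b * (x \<bullet> b))" by blast
  moreover have "(\<lambda>x. \<Sum>b\<in>Basis. f b * (x \<bullet> b)) \<in> polys_upto 1"
    by (intro polys_upto_sum polys_upto_scale coord)
  ultimately show ?case by metis
next
  case (add f g)
  then obtain d e where "f \<in> polys_upto d" "g \<in> polys_upto e" by blast
  then have "f \<in> polys_upto (max d e)" "g \<in> polys_upto (max d e)"
    by (auto intro: polys_upto_mono)
  then show ?case using polys_upto_add by blast
qed (use polys_upto_const polys_upto_mult in blast)+

text \<open>Gaussian elimination, by induction on the set \<open>J\<close> of equations; the members of \<open>I\<close> are the
  unknowns.\<close>
lemma homogeneous_system_nontrivial_solution: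
  fixes A :: "'i \<Rightarrow> 'j \<Rightarrow> real"
  assumes "finite J" "finite I" "card J < card I"
  shows "\<exists>c. (\<exists>i\<in>I. c i \<noteq> 0) \<and> (\<forall>j\<in>J. (\<Sum>i\<in>I. c i * A i j) = 0)"
  using assms
proof (induction J arbitrary: I A)
  case empty
  then obtain i where "i \<in> I" by fastforce
  then show ?case by (intro exI[of _ "\<lambda>_. 1"]) auto
next
  case (insert j J)
  show ?case
  proof (cases "\<forall>i\<in>I. A i j = 0")
    case True
    with insert.IH[of I A] insert.prems insert.hyps show ?thesis by auto
  next
    case False
    then obtain k where k: "k \<in> I" "A k j \<noteq> 0" by blast
    \<comment> \<open>Eliminate the unknown \<open>k\<close> from the remaining equations by means of equation \<open>j\<close>.\<close>
    define B where "B i l = A i l - A i j / A k j * A k l" for i l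
    have "card J < card (I - {k})"
      using insert k by simp
    then obtain c where c: "\<exists>i\<in>I - {k}. c i \<noteq> 0" "\<forall>l\<in>J. (\<Sum>i\<in>I - {k}. c i * B i l) = 0"
      using insert.IH[of "I - {k}" B] insert.prems by auto
    define c' where "c' = c(k := - (\<Sum>i\<in>I - {k}. c i * A i j) / A k j)"
    have split: "(\<Sum>i\<in>I. c' i * A i l)
        = (\<Sum>i\<in>I - {k}. c i * A i l) - (\<Sum>i\<in>I - {k}. c i * A i j) / A k j * A k l" for l
    proof -
      have "(\<Sum>i\<in>I. c' i * A i l) = c' k * A k l + (\<Sum>i\<in>I - {k}. c' i * A i l)"
        using k insert.prems by (simp add: sum.remove)
      also have "(\<Sum>i\<in>I - {k}. c' i * A i l) = (\<Sum>i\<in>I - {k}. c i * A i l)"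
        by (intro sum.cong) (auto simp: c'_def)
      finally show ?thesis by (simp add: c'_def)
    qed
    have "(\<Sum>i\<in>I. c' i * A i l) = (\<Sum>i\<in>I - {k}. c i * B i l)" for l
      unfolding split B_def
      by (simp add: right_diff_distrib sum_subtractf sum_divide_distrib sum_distrib_right
          sum_distrib_left mult_ac)
    with c(2) have "\<forall>l\<in>J. (\<Sum>i\<in>I. c' i * A i l) = 0" by simp
    moreover have "(\<Sum>i\<in>I. c' i * A i j) = 0" using k(2) unfolding split by simp
    moreover have "\<exists>i\<in>I. c' i \<noteq> 0" using c(1) by (auto simp: c'_def)
    ultimately show ?thesis by (intro exI[of _ c']) auto
  qed
qed

text \<open>The products of powers \<open>p\<^sub>i ^ \<alpha>\<^sub>i\<close> with \<open>\<alpha>\<^sub>i \<le> N\<close> number \<open>(N + 1) ^ m\<close>, and they lie in a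
  space spanned by \<open>O(N ^ n)\<close> monomials, where \<open>n\<close> is the dimension. As \<open>m > n\<close>, there are too many
  of them to be linearly independent once \<open>N\<close> is large. The relation is returned with all its
  coefficients nonzero and its exponent vectors extensional, so that distinct members of \<open>E\<close> differ
  below \<open>m\<close>.\<close>
lemma polynomials_algebraically_dependent:
  fixes p :: "nat \<Rightarrow> 'a::euclidean_space \<Rightarrow> real"
  assumes "\<And>i. i < m \<Longrightarrow> real_polynomial_function (p i)" "DIM('a) < m"
  obtains E c where "finite E" "E \<noteq> {}" "E \<subseteq> extensional {..<m}" "\<And>\<alpha>. \<alpha> \<in> E \<Longrightarrow> c \<alpha> \<noteq> 0"
    "\<And>x. (\<Sum>\<alpha>\<in>E. c \<alpha> * (\<Prod>i<m. p i x ^ \<alpha> i)) = 0"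
proof -
  have "\<forall>i. \<exists>d. i < m \<longrightarrow> p i \<in> polys_upto d"
    using assms(1) real_polynomial_function_imp_polys_upto by blast
  then obtain d0 where d0: "\<And>i. i < m \<Longrightarrow> p i \<in> polys_upto (d0 i)" by metis
  define d where "d = (\<Sum>i<m. d0 i)"
  have d: "p i \<in> polys_upto d" if "i < m" for i
    using d0[OF that] that unfolding d_def by (auto intro: polys_upto_mono member_le_sum)
  \<comment> \<open>Monomials of degree at most \<open>m N d\<close> in each variable suffice, and
    \<open>(m N d + 1) ^ n \<le> (m d + 1) ^ n (N + 1) ^ n = N (N + 1) ^ n\<close> for this choice of \<open>N\<close>.\<close>
  define N where "N = Suc (m * d) ^ DIM('a)"
  define I where "I = ({..<m} \<rightarrow>\<^sub>E {..N})"
  have finI: "finite I" by (simp add: I_def finite_PiE)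
  define D where "D = m * (N * d)"
  have "(\<lambda>x. \<Prod>i<m. p i x ^ \<alpha> i) \<in> polys_upto D" if "\<alpha> \<in> I" for \<alpha>
  proof -
    have "(\<lambda>x. p i x ^ \<alpha> i) \<in> polys_upto (N * d)" if "i < m" for i
    proof -
      have "\<alpha> i \<le> N" using \<open>\<alpha> \<in> I\<close> that by (auto simp: I_def)
      then show ?thesis using polys_upto_power[OF d[OF that], of "\<alpha> i"]
        by (auto intro: polys_upto_mono)
    qed
    then show ?thesis using polys_upto_prod[of "{..<m}" "\<lambda>i x. p i x ^ \<alpha> i" "N * d"]
      by (simp add: D_def)
  qed
  then obtain A where A: "\<And>\<alpha> x. \<alpha> \<in> I \<Longrightarrow> (\<Prod>i<m. p i x ^ \<alpha> i)
      = (\<Sum>\<beta>\<in>exponents_upto D. A \<alpha> \<beta> * monomial_fun \<beta> x)"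
    unfolding polys_upto_def mem_Collect_eq by metis
  have "card (exponents_upto D :: ('a \<Rightarrow> nat) set) < card I"
  proof -
    have "Suc D ^ DIM('a) \<le> (Suc (m * d) * Suc N) ^ DIM('a)"
      by (intro power_mono) (auto simp: D_def)
    also have "\<dots> = N * Suc N ^ DIM('a)" unfolding N_def power_mult_distrib ..
    also have "\<dots> < Suc N * Suc N ^ DIM('a)" by (intro mult_strict_right_mono) simp_all
    also have "\<dots> = Suc N ^ Suc (DIM('a))" by simp
    also have "\<dots> \<le> Suc N ^ m" using assms(2) by (intro power_increasing) auto
    finally show ?thesis by (simp add: card_exponents_upto I_def card_PiE)
  qed
  from homogeneous_system_nontrivial_solution[OF finite_exponents_upto finI this, of A]
  obtain c where c: "\<exists>\<alpha>\<in>I. c \<alpha> \<noteq> 0"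
    "\<And>\<beta>. \<beta> \<in> exponents_upto D \<Longrightarrow> (\<Sum>\<alpha>\<in>I. c \<alpha> * A \<alpha> \<beta>) = 0" by auto
  have zero: "(\<Sum>\<alpha>\<in>I. c \<alpha> * (\<Prod>i<m. p i x ^ \<alpha> i)) = 0" for x
  proof -
    have "(\<Sum>\<alpha>\<in>I. c \<alpha> * (\<Prod>i<m. p i x ^ \<alpha> i))
        = (\<Sum>\<alpha>\<in>I. \<Sum>\<beta>\<in>exponents_upto D. (c \<alpha> * A \<alpha> \<beta>) * monomial_fun \<beta> x)"
      by (intro sum.cong) (simp_all add: A sum_distrib_left mult.assoc)
    also have "\<dots> = (\<Sum>\<beta>\<in>exponents_upto D. (\<Sum>\<alpha>\<in>I. c \<alpha> * A \<alpha> \<beta>) * monomial_fun \<beta> x)"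
      by (subst sum.swap) (simp add: sum_distrib_right)
    finally show ?thesis by (simp add: c(2))
  qed
  show ?thesis
  proof (rule that[of "{\<alpha>\<in>I. c \<alpha> \<noteq> 0}" c])
    show "(\<Sum>\<alpha>\<in>{\<alpha>\<in>I. c \<alpha> \<noteq> 0}. c \<alpha> * (\<Prod>i<m. p i x ^ \<alpha> i)) = 0" for x
      using zero[of x] by (subst sum.mono_neutral_left[OF finI]) auto
    show "finite {\<alpha>\<in>I. c \<alpha> \<noteq> 0}" using finI by simp
  qed (use c(1) in \<open>auto simp: I_def PiE_def\<close>)
qed

section \<open>Krull dimension of polynomial rings on sets\<close>

lemma cring_polynomial_ring_on: "cring (polynomial_ring_on A)"
proof (rule cringI)
  show "abelian_group (polynomial_ring_on A)"
  proof (rule abelian_groupI)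
    fix f assume "f \<in> carrier (polynomial_ring_on A)"
    then obtain p where p: "real_polynomial_function p" "f = restrict p A"
      by (auto simp: polynomial_ring_on_def)
    show "\<exists>g\<in>carrier (polynomial_ring_on A).
        g \<oplus>\<^bsub>polynomial_ring_on A\<^esub> f = \<zero>\<^bsub>polynomial_ring_on A\<^esub>"
      by (rule bexI[of _ "restrict (\<lambda>x. - p x) A"])
        (use p in \<open>auto simp: polynomial_ring_on_def fun_eq_iff\<close>)
  qed (fastforce simp: polynomial_ring_on_def fun_eq_iff restrict_def extensional_def)+
  show "comm_monoid (polynomial_ring_on A)"
    by (rule comm_monoidI)
      (fastforce simp: polynomial_ring_on_def fun_eq_iff restrict_def)+
qed (auto simp: polynomial_ring_on_def fun_eq_iff restrict_def algebra_simps)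

lemma primeideal_polynomial_ring_onD:
  assumes "primeideal P (polynomial_ring_on A)"
  shows primeideal_polynomial_add: "\<And>p q. restrict p A \<in> P \<Longrightarrow> restrict q A \<in> P \<Longrightarrow>
      restrict (\<lambda>x. p x + q x) A \<in> P"
    and primeideal_polynomial_mult: "\<And>p q. restrict p A \<in> P \<Longrightarrow> real_polynomial_function q \<Longrightarrow>
      restrict (\<lambda>x. p x * q x) A \<in> P"
    and primeideal_polynomial_cases: "\<And>p q. real_polynomial_function p \<Longrightarrow>
      real_polynomial_function q \<Longrightarrow> restrict (\<lambda>x. p x * q x) A \<in> P \<Longrightarrow>
      restrict p A \<in> P \<or> restrict q A \<in> P"
    and primeideal_polynomial_const: "\<And>c. c \<noteq> 0 \<Longrightarrow> restrict (\<lambda>x. c) A \<notin> P"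
proof -
  interpret primeideal P "polynomial_ring_on A" by fact
  have add: "add (polynomial_ring_on A) (restrict p A) (restrict q A)
      = restrict (\<lambda>x. p x + q x) A" for p q
    by (auto simp: polynomial_ring_on_def)
  have mult: "mult (polynomial_ring_on A) (restrict p A) (restrict q A)
      = restrict (\<lambda>x. p x * q x) A" for p q
    by (auto simp: polynomial_ring_on_def)
  have carr: "restrict p A \<in> carrier (polynomial_ring_on A)"
    if "real_polynomial_function p" for p
    using that by (auto simp: polynomial_ring_on_def)
  show "restrict (\<lambda>x. p x + q x) A \<in> P" if "restrict p A \<in> P" "restrict q A \<in> P" for p q
    using additive_subgroup.a_closed[OF additive_subgroup_axioms that] by (simp add: add)
  show mem: "restrict (\<lambda>x. p x * q x) A \<in> P"
    if "restrict p A \<in> P" "real_polynomial_function q" for p q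
    using I_r_closed[OF that(1) carr[OF that(2)]] by (simp add: mult)
  show "restrict p A \<in> P \<or> restrict q A \<in> P"
    if "real_polynomial_function p" "real_polynomial_function q"
      "restrict (\<lambda>x. p x * q x) A \<in> P" for p q
    using I_prime[OF carr carr] that by (simp add: mult)
  show "restrict (\<lambda>x. c) A \<notin> P" if "c \<noteq> 0" for c
  proof
    assume "restrict (\<lambda>x. c) A \<in> P"
    from mem[OF this, of "\<lambda>x. 1 / c"] that
    have "one (polynomial_ring_on A) \<in> P" by (auto simp: polynomial_ring_on_def)
    then show False using one_imp_carrier I_notcarr by blast
  qed
qed

lemma primeideal_polynomial_power:
  assumes "primeideal P (polynomial_ring_on A)" "real_polynomial_function p"
    "restrict p A \<notin> P"
  shows "restrict (\<lambda>x. p x ^ k) A \<notin> P"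
proof (induction k)
  case 0
  show ?case unfolding power_0 by (rule primeideal_polynomial_const[OF assms(1)]) simp
next
  case (Suc k)
  then show ?case
    unfolding power_Suc
    using primeideal_polynomial_cases[OF assms(1,2) real_polynomial_function_power[OF assms(2)]]
      assms(3) by blast
qed

text \<open>Going up the chain in steps: let \<open>e\<close> be the least exponent of \<open>f\<^sub>k\<close> in the given expression,
  and write the expression as \<open>f\<^sub>k ^ e (g + h f\<^sub>k)\<close>, where \<open>g\<close> no longer involves \<open>f\<^sub>k\<close>. If it were
  in \<open>P\<^sub>k\<close>, then so would be \<open>g + h f\<^sub>k\<close>, since \<open>f\<^sub>k \<notin> P\<^sub>k\<close>; hence \<open>g \<in> P\<^sub>k\<^sub>+\<^sub>1\<close>, since \<open>f\<^sub>k \<in> P\<^sub>k\<^sub>+\<^sub>1\<close>. At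
  the top of the chain only a nonzero constant remains. The injectivity assumption says that no two
  monomials coincide, so that the coefficients cannot cancel; it passes to the monomials of \<open>g\<close>
  because these have the same exponent at \<open>k\<close>.\<close>
lemma polynomial_in_chain_elements_not_in_bottom:
  fixes P :: "nat \<Rightarrow> ('a::euclidean_space \<Rightarrow> real) set"
  assumes prime: "\<And>i. i \<le> m \<Longrightarrow> primeideal (P i) (polynomial_ring_on A)"
    and chain: "\<And>i. i < m \<Longrightarrow> P i \<subseteq> P (Suc i)"
    and f: "\<And>i. i < m \<Longrightarrow> real_polynomial_function (f i)"
    and f_notin: "\<And>i. i < m \<Longrightarrow> restrict (f i) A \<notin> P i"
    and f_in: "\<And>i. i < m \<Longrightarrow> restrict (f i) A \<in> P (Suc i)"
    and "k \<le> m" "finite E" "E \<noteq> {}" "inj_on (\<lambda>\<alpha>. restrict \<alpha> {k..<m}) E"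
    and "\<And>\<alpha>. \<alpha> \<in> E \<Longrightarrow> c \<alpha> \<noteq> 0"
  shows "restrict (\<lambda>x. \<Sum>\<alpha>\<in>E. c \<alpha> * (\<Prod>i=k..<m. f i x ^ \<alpha> i)) A \<notin> P k"
  using assms(6-)
proof (induction k arbitrary: E rule: inc_induct)
  case base
  then obtain \<alpha> where "E = {\<alpha>}"
    by (auto simp: inj_on_def)
  with base(4) have "c \<alpha> \<noteq> 0"
    "(\<lambda>x. \<Sum>\<alpha>\<in>E. c \<alpha> * (\<Prod>i=m..<m. f i x ^ \<alpha> i)) = (\<lambda>x. c \<alpha>)" by auto
  then show ?case using primeideal_polynomial_const[OF prime[OF order_refl]] by metis
next
  case (step k)
  define e where "e = Min ((\<lambda>\<alpha>. \<alpha> k) ` E)"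
  define E0 where "E0 = {\<alpha>\<in>E. \<alpha> k = e}"
  have e_le: "e \<le> \<alpha> k" if "\<alpha> \<in> E" for \<alpha>
    using that step.prems(1) by (simp add: e_def)
  have "e \<in> (\<lambda>\<alpha>. \<alpha> k) ` E" unfolding e_def using step.prems by (intro Min_in) auto
  then have "E0 \<noteq> {}" by (auto simp: E0_def)
  define M where "M \<alpha> x = c \<alpha> * (\<Prod>i=Suc k..<m. f i x ^ \<alpha> i)" for \<alpha> x
  define g where "g x = (\<Sum>\<alpha>\<in>E0. M \<alpha> x)" for x
  define h where "h x = (\<Sum>\<alpha>\<in>E - E0. f k x ^ (\<alpha> k - Suc e) * M \<alpha> x)" for x
  have pk: "primeideal (P k) (polynomial_ring_on A)"
    "primeideal (P (Suc k)) (polynomial_ring_on A)" using prime step.hyps by auto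
  have fin: "finite E0" "finite (E - E0)" using step.prems(1) by (auto simp: E0_def)
  have poly_M: "real_polynomial_function (M \<alpha>)" for \<alpha>
    unfolding M_def
    by (intro real_polynomial_function.intros real_polynomial_function_prod
        real_polynomial_function_power f) auto
  have poly: "real_polynomial_function g" "real_polynomial_function h"
    unfolding g_def h_def
    by (intro real_polynomial_function_sum real_polynomial_function.intros(4) poly_M fin
        real_polynomial_function_power f step.hyps)+
  have split: "(\<Sum>\<alpha>\<in>E. c \<alpha> * (\<Prod>i=k..<m. f i x ^ \<alpha> i))
      = f k x ^ e * (g x + h x * f k x)" for x
  proof -
    have "(\<Sum>\<alpha>\<in>E. c \<alpha> * (\<Prod>i=k..<m. f i x ^ \<alpha> i)) = (\<Sum>\<alpha>\<in>E. f k x ^ \<alpha> k * M \<alpha> x)"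
      using step.hyps by (simp add: M_def prod.atLeast_Suc_lessThan mult_ac)
    also have "\<dots> = (\<Sum>\<alpha>\<in>E0. f k x ^ \<alpha> k * M \<alpha> x) + (\<Sum>\<alpha>\<in>E - E0. f k x ^ \<alpha> k * M \<alpha> x)"
      using step.prems(1) by (subst sum.subset_diff[of E0]) (auto simp: E0_def)
    also have "(\<Sum>\<alpha>\<in>E0. f k x ^ \<alpha> k * M \<alpha> x) = f k x ^ e * g x"
      by (simp add: g_def E0_def sum_distrib_left)
    also have "(\<Sum>\<alpha>\<in>E - E0. f k x ^ \<alpha> k * M \<alpha> x) = f k x ^ e * (h x * f k x)"
    proof -
      have "f k x ^ \<alpha> k * M \<alpha> x = f k x ^ e * (f k x ^ (\<alpha> k - Suc e) * M \<alpha> x * f k x)"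
        if "\<alpha> \<in> E - E0" for \<alpha>
      proof -
        have "\<alpha> k = e + Suc (\<alpha> k - Suc e)"
          using that e_le[of \<alpha>] by (force simp: E0_def)
        then have "f k x ^ \<alpha> k = f k x ^ e * (f k x * f k x ^ (\<alpha> k - Suc e))"
          by (metis power_Suc power_add)
        then show ?thesis by simp
      qed
      then show ?thesis
        unfolding h_def sum_distrib_left sum_distrib_right by (intro sum.cong refl) blast
    qed
    finally show ?thesis by (simp add: distrib_left)
  qed
  show ?case
  proof
    assume "restrict (\<lambda>x. \<Sum>\<alpha>\<in>E. c \<alpha> * (\<Prod>i=k..<m. f i x ^ \<alpha> i)) A \<in> P k"
    then have "restrict (\<lambda>x. g x + h x * f k x) A \<in> P k"
      unfolding split
      using primeideal_polynomial_cases[OF pk(1), of "\<lambda>x. f k x ^ e" "\<lambda>x. g x + h x * f k x"]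
        primeideal_polynomial_power[OF pk(1) f[OF step.hyps(2)] f_notin[OF step.hyps(2)], of e]
        real_polynomial_function_power[OF f[OF step.hyps(2)]]
        real_polynomial_function.intros(3)[OF poly(1)
          real_polynomial_function.intros(4)[OF poly(2) f[OF step.hyps(2)]]]
      by blast
    then have "restrict (\<lambda>x. g x + h x * f k x) A \<in> P (Suc k)"
      using chain step.hyps by blast
    moreover have "restrict (\<lambda>x. f k x * (- h x)) A \<in> P (Suc k)"
      using primeideal_polynomial_mult[OF pk(2) f_in, of "\<lambda>x. - h x"] step.hyps poly(2)
      by (auto intro: real_polynomial_function_minus)
    ultimately have "restrict (\<lambda>x. (g x + h x * f k x) + f k x * (- h x)) A \<in> P (Suc k)"
      by (rule primeideal_polynomial_add[OF pk(2)])
    then have "restrict g A \<in> P (Suc k)" by (simp add: mult.commute)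
    moreover have "inj_on (\<lambda>\<alpha>. restrict \<alpha> {Suc k..<m}) E0"
    proof (rule inj_onI)
      fix \<alpha> \<beta> assume ab: "\<alpha> \<in> E0" "\<beta> \<in> E0"
        "restrict \<alpha> {Suc k..<m} = restrict \<beta> {Suc k..<m}"
      have "\<alpha> i = \<beta> i" if "i \<in> {k..<m}" for i
      proof (cases "i = k")
        case True
        then show ?thesis using ab by (simp add: E0_def)
      next
        case False
        then show ?thesis using that fun_cong[OF ab(3), of i] by auto
      qed
      then have "restrict \<alpha> {k..<m} = restrict \<beta> {k..<m}" by (rule restrict_ext)
      then show "\<alpha> = \<beta>"
        using inj_onD[OF step.prems(3)] ab(1,2) unfolding E0_def by blast
    qed
    moreover have "c \<alpha> \<noteq> 0" if "\<alpha> \<in> E0" for \<alpha>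
      using that step.prems(4) by (simp add: E0_def)
    ultimately show False
      using step.IH[OF fin(1) \<open>E0 \<noteq> {}\<close>] unfolding g_def[abs_def] M_def by blast
  qed
qed

text \<open>A longer chain would provide more than \<open>DIM('a)\<close> polynomials, one for each strict inclusion.
  Their algebraic dependence puts an expression with value \<open>0\<close> outside the bottom prime.\<close>
lemma semialgebraic_dim_le_DIM:
  fixes A :: "'a::euclidean_space set"
  shows "semialgebraic_dim A \<le> enat (DIM('a))"
  unfolding semialgebraic_dim_def krull_dim_def
proof (rule Sup_least, clarify)
  fix d and P :: "nat \<Rightarrow> ('a \<Rightarrow> real) set"
  assume prime: "\<forall>i\<le>d. primeideal (P i) (polynomial_ring_on A)"
    and chain: "\<forall>i<d. P i \<subset> P (Suc i)"
  show "enat d \<le> enat (DIM('a))"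
  proof (rule ccontr)
    assume "\<not> ?thesis"
    then have d: "DIM('a) < d" by simp
    have "\<forall>i\<in>{..<d}. \<exists>p. real_polynomial_function p \<and>
        restrict p A \<in> P (Suc i) \<and> restrict p A \<notin> P i"
    proof
      fix i assume "i \<in> {..<d}"
      then have i: "i < d" by simp
      interpret primeideal "P (Suc i)" "polynomial_ring_on A" using prime i by simp
      obtain g where g: "g \<in> P (Suc i)" "g \<notin> P i" 
        using psubset_imp_ex_mem[OF chain[rule_format, OF i]] by auto
      then have "g \<in> carrier (polynomial_ring_on A)" using a_subset by blast
      then obtain p where "real_polynomial_function p" "g = restrict p A"
        by (auto simp: polynomial_ring_on_def)
      with g show "\<exists>p. real_polynomial_function p \<and>
          restrict p A \<in> P (Suc i) \<and> restrict p A \<notin> P i"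
        by blast
    qed
    from bchoice[OF this] obtain f where f: "\<And>i. i < d \<Longrightarrow> real_polynomial_function (f i)"
      "\<And>i. i < d \<Longrightarrow> restrict (f i) A \<in> P (Suc i)"
      "\<And>i. i < d \<Longrightarrow> restrict (f i) A \<notin> P i" by blast
    obtain E c where E: "finite E" "E \<noteq> {}" "E \<subseteq> extensional {0..<d}"
      "\<And>\<alpha>. \<alpha> \<in> E \<Longrightarrow> c \<alpha> \<noteq> 0" "\<And>x. (\<Sum>\<alpha>\<in>E. c \<alpha> * (\<Prod>i=0..<d. f i x ^ \<alpha> i)) = 0"
      by (rule polynomials_algebraically_dependent[of d f, OF f(1) d, unfolded lessThan_atLeast0],
          assumption) (rule that)
    have "inj_on (\<lambda>\<alpha>. restrict \<alpha> {0..<d}) E"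
    proof (rule inj_onI)
      fix \<alpha> \<beta> assume "\<alpha> \<in> E" "\<beta> \<in> E" "restrict \<alpha> {0..<d} = restrict \<beta> {0..<d}"
      then show "\<alpha> = \<beta>"
        using extensional_restrict[OF subsetD[OF E(3)]] by metis
    qed
    then have "restrict (\<lambda>x. \<Sum>\<alpha>\<in>E. c \<alpha> * (\<Prod>i=0..<d. f i x ^ \<alpha> i)) A \<notin> P 0"
      using prime chain
        polynomial_in_chain_elements_not_in_bottom[of d P A f 0 E c, OF _ _ f(1,3,2) _ E(1,2) _ E(4)]
      by (simp add: psubset_imp_subset)
    then have "restrict (\<lambda>x. 0) A \<notin> P 0" unfolding E(5) .
    moreover have "\<zero>\<^bsub>polynomial_ring_on A\<^esub> \<in> P 0"
    proof -
      interpret primeideal "P 0" "polynomial_ring_on A" using prime by simp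
      show ?thesis by (rule additive_subgroup.zero_closed[OF additive_subgroup_axioms])
    qed
    ultimately show False by (simp add: polynomial_ring_on_def)
  qed
qed

text \<open>If \<open>p\<close> does not vanish at \<open>u\<close> and \<open>q\<close> does not vanish at \<open>v\<close>, then on the line through \<open>u\<close>
  and \<open>v\<close> both are nonzero polynomials in one variable, so that their product has finitely many
  zeros there, and it cannot vanish on the whole segment.\<close>
lemma polynomial_product_zero_on_convex:
  fixes p q :: "'a::euclidean_space \<Rightarrow> real"
  assumes "convex C" "real_polynomial_function p" "real_polynomial_function q"
    and "\<And>x. x \<in> C \<Longrightarrow> p x * q x = 0"
  shows "(\<forall>x\<in>C. p x = 0) \<or> (\<forall>x\<in>C. q x = 0)"
proof (rule ccontr)
  assume "\<not> ?thesis"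
  then obtain u v where uv: "u \<in> C" "p u \<noteq> 0" "v \<in> C" "q v \<noteq> 0" by blast
  define l where "l s = u + s *\<^sub>R (v - u)" for s
  have l: "polynomial_function l"
    unfolding l_def
    by (intro polynomial_function_add polynomial_function_const polynomial_function_bounded_linear
        bounded_linear_scaleR_left)
  have l_C: "l s \<in> C" if "s \<in> {0..1}" for s
  proof -
    have "l s = (1 - s) *\<^sub>R u + s *\<^sub>R v" by (simp add: l_def algebra_simps)
    then show ?thesis using that uv assms(1) by (simp add: convexD)
  qed
  have zeros: "finite {s. r (l s) = 0}"
    if r: "real_polynomial_function r" and s: "r (l s) \<noteq> 0" for r s
  proof -
    have "real_polynomial_function (r \<circ> l)"
      using l r by (rule real_polynomial_function_compose)
    then obtain a n where a: "r \<circ> l = (\<lambda>s. \<Sum>i\<le>n. a i * s ^ i)"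
      using real_polynomial_function_imp_sum by blast
    have "\<exists>i\<le>n. a i \<noteq> 0"
      using s fun_cong[OF a, of s] by (metis (no_types, lifting) atMost_iff comp_apply mult_zero_left sum.neutral)
    then have "finite {s. (\<Sum>i\<le>n. a i * s ^ i) = 0}" by (simp add: polyfun_finite_roots)
    then show ?thesis using fun_cong[OF a] by simp
  qed
  have "finite {s. p (l s) = 0}" "finite {s. q (l s) = 0}"
    using zeros[OF assms(2), of 0] zeros[OF assms(3), of 1] uv by (simp_all add: l_def)
  moreover have "{0..1::real} \<subseteq> {s. p (l s) = 0} \<union> {s. q (l s) = 0}"
    using assms(4)[OF l_C] mult_eq_0_iff by blast
  ultimately have "finite {0..1::real}" by (meson finite_UnI finite_subset)
  then show False using infinite_Icc[of "0::real" 1] by simp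
qed

definition vanishing_ideal :: "'a set \<Rightarrow> 'a set \<Rightarrow> ('a::euclidean_space \<Rightarrow> real) set" where
  "vanishing_ideal A C = {f \<in> carrier (polynomial_ring_on A). \<forall>x\<in>C. f x = 0}"

lemma vanishing_ideal_of_convex_prime:
  assumes "convex C" "C \<noteq> {}" "C \<subseteq> A"
  shows "primeideal (vanishing_ideal A C) (polynomial_ring_on A)"
proof -
  interpret cring "polynomial_ring_on A" by (rule cring_polynomial_ring_on)
  let ?R = "polynomial_ring_on A"
  have eval: "(f \<oplus>\<^bsub>?R\<^esub> g) x = f x + g x" "(f \<otimes>\<^bsub>?R\<^esub> g) x = f x * g x"
    "\<zero>\<^bsub>?R\<^esub> x = 0" "\<one>\<^bsub>?R\<^esub> x = 1" if "x \<in> C" for f g x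
    using that assms(3) by (auto simp: polynomial_ring_on_def)
  have neg: "(\<ominus>\<^bsub>?R\<^esub> f) x = - f x" if "f \<in> carrier ?R" "x \<in> C" for f x
  proof -
    have "(f \<oplus>\<^bsub>?R\<^esub> \<ominus>\<^bsub>?R\<^esub> f) x = 0" using that by (simp add: r_neg eval)
    then show ?thesis using that by (simp add: eval)
  qed
  show ?thesis
  proof (rule primeidealI)
    show "ideal (vanishing_ideal A C) ?R"
    proof (rule idealI)
      show "subgroup (vanishing_ideal A C) (add_monoid ?R)"
        by (rule add.subgroupI) (auto simp: vanishing_ideal_def eval neg simp flip: a_inv_def)
    qed (auto simp: vanishing_ideal_def eval ring_axioms)
    show "carrier ?R \<noteq> vanishing_ideal A C"
    proof
      assume "carrier ?R = vanishing_ideal A C"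
      then have "\<one>\<^bsub>?R\<^esub> \<in> vanishing_ideal A C" by (metis one_closed)
      then show False using assms(2) by (auto simp: vanishing_ideal_def eval)
    qed
    fix f g assume fg: "f \<in> carrier ?R" "g \<in> carrier ?R" "f \<otimes>\<^bsub>?R\<^esub> g \<in> vanishing_ideal A C"
    then obtain p q where pq: "real_polynomial_function p" "f = restrict p A"
      "real_polynomial_function q" "g = restrict q A"
      by (auto simp: polynomial_ring_on_def)
    have "p x * q x = 0" if x: "x \<in> C" for x
    proof -
      have "(f \<otimes>\<^bsub>?R\<^esub> g) x = 0" using fg(3) x by (simp add: vanishing_ideal_def)
      then show ?thesis using x assms(3) by (simp add: eval pq(2,4) subset_iff)
    qed
    from polynomial_product_zero_on_convex[OF assms(1) pq(1,3) this]
    show "f \<in> vanishing_ideal A C \<or> g \<in> vanishing_ideal A C"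
      using fg(1,2) assms(3) by (auto simp: vanishing_ideal_def pq)
  qed (rule cring_polynomial_ring_on)
qed

text \<open>The flag consists of the slices \<open>C i\<close> of \<open>A\<close> by affine subspaces of codimension \<open>i\<close> through an
  interior point \<open>z\<close>. The \<open>i\<close>-th coordinate relative to \<open>z\<close> vanishes on \<open>C (Suc i)\<close>, but not on
  \<open>C i\<close>, which extends a little in the direction \<open>b i\<close>.\<close>
lemma semialgebraic_dim_convex:
  fixes A :: "'a::euclidean_space set"
  assumes "convex A" "interior A \<noteq> {}"
  shows "semialgebraic_dim A = enat (DIM('a))"
proof (rule antisym[OF semialgebraic_dim_le_DIM])
  obtain z \<epsilon> where z: "\<epsilon> > 0" "cball z \<epsilon> \<subseteq> A"
    using assms(2) by (auto simp: mem_interior_cball)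
  obtain b where b: "bij_betw b {0..<DIM('a)} (Basis :: 'a set)"
    using ex_bij_betw_nat_finite[of "Basis :: 'a set"] by auto
  define C where "C i = A \<inter> {x. \<forall>j<i. (x - z) \<bullet> b j = 0}" for i
  have "convex (C i)" for i
  proof -
    have "convex {x. \<forall>j<i. (x - z) \<bullet> b j = 0}"
      by (auto simp: convex_def inner_diff_left inner_add_left simp flip: distrib_right)
    then show ?thesis unfolding C_def using assms(1) by (rule convex_Int[rotated])
  qed
  moreover have "z \<in> C i" for i using z by (auto simp: C_def)
  ultimately have prime: "primeideal (vanishing_ideal A (C i)) (polynomial_ring_on A)" for i
    by (intro vanishing_ideal_of_convex_prime) (auto simp: C_def)
  have strict: "vanishing_ideal A (C i) \<subset> vanishing_ideal A (C (Suc i))" if i: "i < DIM('a)" for i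
  proof
    show "vanishing_ideal A (C i) \<subseteq> vanishing_ideal A (C (Suc i))"
      by (auto simp: vanishing_ideal_def C_def)
    define f where "f = restrict (\<lambda>x. x \<bullet> b i - z \<bullet> b i) A"
    have bi: "b i \<in> Basis" using b i by (auto simp: bij_betw_def)
    have ortho: "b i \<bullet> b j = 0" if "j < i" for j
    proof -
      have "b j \<noteq> b i"
        using b i that by (auto simp: bij_betw_def dest: inj_onD)
      moreover have "b j \<in> Basis" using b i that by (auto simp: bij_betw_def)
      ultimately show ?thesis using bi by (simp add: inner_Basis)
    qed
    have "real_polynomial_function (\<lambda>x. x \<bullet> b i - z \<bullet> b i)"
      by (intro real_polynomial_function_diff real_polynomial_function.intros
          bounded_linear_inner_left)
    then have "f \<in> carrier (polynomial_ring_on A)"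
      by (auto simp: polynomial_ring_on_def f_def)
    then have "f \<in> vanishing_ideal A (C (Suc i))"
      by (auto simp: vanishing_ideal_def C_def f_def inner_diff_left)
    moreover have "z + \<epsilon> *\<^sub>R b i \<in> A"
      using z bi by (intro subsetD[OF z(2)]) (simp add: dist_norm)
    then have "z + \<epsilon> *\<^sub>R b i \<in> C i" "f (z + \<epsilon> *\<^sub>R b i) \<noteq> 0"
      using z bi ortho by (auto simp: C_def f_def inner_add_left)
    then have "f \<notin> vanishing_ideal A (C i)" by (auto simp: vanishing_ideal_def)
    ultimately show "vanishing_ideal A (C i) \<noteq> vanishing_ideal A (C (Suc i))" by blast
  qed
  show "enat (DIM('a)) \<le> semialgebraic_dim A"
    unfolding semialgebraic_dim_def krull_dim_def
    by (intro Sup_upper CollectI exI[of _ "DIM('a)"] conjI refl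
        exI[of _ "\<lambda>i. vanishing_ideal A (C i)"]) (use prime strict in blast)+
qed

section \<open>Convex polynomial images of a ball\<close>

lemma polynomial_over_C0_monomial:
  assumes "continuous_on {0..1} g"
  shows "polynomial_over_C0 (\<lambda>(t, x). g t * (\<Prod>j\<in>UNIV. (x $ j) ^ \<alpha> j))"
  unfolding polynomial_over_C0_def
  by (rule exI[of _ "{\<alpha>}"], rule exI[of _ "\<lambda>_. g"]) (use assms in auto)

lemma polynomial_over_C0_add:
  assumes "polynomial_over_C0 h" "polynomial_over_C0 k"
  shows "polynomial_over_C0 (\<lambda>z. h z + k z)"
proof -
  obtain M c where M: "finite M" "\<forall>\<alpha>\<in>M. continuous_on {0..1} (c \<alpha>)"
    "\<forall>t\<in>{0..1}. \<forall>x\<in>cball 0 1. h (t, x) = (\<Sum>\<alpha>\<in>M. c \<alpha> t * (\<Prod>j\<in>UNIV. (x $ j) ^ \<alpha> j))"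
    using assms(1) unfolding polynomial_over_C0_def by blast
  obtain N d where N: "finite N" "\<forall>\<alpha>\<in>N. continuous_on {0..1} (d \<alpha>)"
    "\<forall>t\<in>{0..1}. \<forall>x\<in>cball 0 1. k (t, x) = (\<Sum>\<alpha>\<in>N. d \<alpha> t * (\<Prod>j\<in>UNIV. (x $ j) ^ \<alpha> j))"
    using assms(2) unfolding polynomial_over_C0_def by blast
  define e where "e \<alpha> t = (if \<alpha> \<in> M then c \<alpha> t else 0) + (if \<alpha> \<in> N then d \<alpha> t else 0)" for \<alpha> t
  have "continuous_on {0..1} (e \<alpha>)" for \<alpha>
    using M(2) N(2) unfolding e_def
    by (cases "\<alpha> \<in> M"; cases "\<alpha> \<in> N") (auto intro!: continuous_intros)
  moreover have "(\<Sum>\<alpha>\<in>M \<union> N. e \<alpha> t * w \<alpha>) = (\<Sum>\<alpha>\<in>M. c \<alpha> t * w \<alpha>) + (\<Sum>\<alpha>\<in>N. d \<alpha> t * w \<alpha>)"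
    for t w
  proof -
    have "(\<Sum>\<alpha>\<in>M. c \<alpha> t * w \<alpha>) = (\<Sum>\<alpha>\<in>M \<union> N. (if \<alpha> \<in> M then c \<alpha> t else 0) * w \<alpha>)"
      using M(1) N(1) by (intro sum.mono_neutral_cong_left) auto
    moreover have "(\<Sum>\<alpha>\<in>N. d \<alpha> t * w \<alpha>) = (\<Sum>\<alpha>\<in>M \<union> N. (if \<alpha> \<in> N then d \<alpha> t else 0) * w \<alpha>)"
      using M(1) N(1) by (intro sum.mono_neutral_cong_left) auto
    ultimately show ?thesis by (simp add: e_def distrib_right sum.distrib)
  qed
  ultimately show ?thesis
    unfolding polynomial_over_C0_def using M N
    by (intro exI[of _ "M \<union> N"] exI[of _ e]) simp
qed

lemma polynomial_over_C0_sum: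
  assumes "finite I" "\<And>i. i \<in> I \<Longrightarrow> polynomial_over_C0 (h i)"
  shows "polynomial_over_C0 (\<lambda>z. \<Sum>i\<in>I. h i z)"
  using assms
proof (induction I)
  case empty
  then show ?case using polynomial_over_C0_monomial[of "\<lambda>_. 0"] by (simp add: case_prod_unfold)
qed (simp add: polynomial_over_C0_add)

text \<open>This links the coordinate-free notion of polynomial function to the explicit sums of
  monomials in the definition of a brick.\<close>
lemma polynomial_over_C0_scaled_polynomial:
  fixes p :: "real ^ 'm \<Rightarrow> real"
  assumes "real_polynomial_function p" "continuous_on {0..1} g"
  shows "polynomial_over_C0 (\<lambda>(t, x). g t * p x)"
proof -
  obtain d c where c: "\<And>x. p x = (\<Sum>\<alpha>\<in>exponents_upto d. c \<alpha> * monomial_fun \<alpha> x)"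
    using real_polynomial_function_imp_polys_upto[OF assms(1)] by (auto simp: polys_upto_def)
  have mono: "monomial_fun \<alpha> x = (\<Prod>j\<in>UNIV. (x $ j) ^ \<alpha> (axis j 1))"
    for \<alpha> and x :: "real ^ 'm"
  proof -
    have Basis: "(Basis :: (real ^ 'm) set) = (\<lambda>j. axis j 1) ` UNIV"
      by (auto simp: Basis_vec_def)
    have "inj (\<lambda>j. axis j 1 :: real ^ 'm)" by (auto simp: inj_on_def axis_eq_axis)
    then show ?thesis
      unfolding monomial_fun_def Basis by (simp add: prod.reindex inner_axis)
  qed
  have "(\<lambda>(t, x). g t * p x) = (\<lambda>z. \<Sum>\<alpha>\<in>exponents_upto d.
      (case z of (t, x) \<Rightarrow> (g t * c \<alpha>) * (\<Prod>j\<in>UNIV. (x $ j) ^ \<alpha> (axis j 1))))"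
    by (auto simp: c mono sum_distrib_left mult.assoc)
  moreover have "polynomial_over_C0 (\<lambda>z. \<Sum>\<alpha>\<in>exponents_upto d.
      (case z of (t, x) \<Rightarrow> (g t * c \<alpha>) * (\<Prod>j\<in>UNIV. (x $ j) ^ \<alpha> (axis j 1))))"
    by (intro polynomial_over_C0_sum finite_exponents_upto
        polynomial_over_C0_monomial[of _ "\<lambda>j. _ (axis j 1)"] continuous_intros assms(2))
  ultimately show ?thesis by simp
qed

text \<open>The contraction to an interior point \<open>p\<close> along straight lines has polynomial coordinates with
  coefficients that are affine in \<open>t\<close>, and convexity keeps it in the interior for \<open>t > 0\<close>.\<close>
theorem brick_convex_polynomial_image:
  fixes T :: "(real ^ 'n) set" and F :: "real ^ 'm \<Rightarrow> real ^ 'n"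
  assumes "semialgebraic T" "convex T" "interior T \<noteq> {}"
    and F: "polynomial_function F" "F ` cball 0 1 = T"
  shows "brick TYPE('m) T"
proof -
  obtain p where p: "p \<in> interior T" using assms(3) by blast
  define H where "H = (\<lambda>(t, x). (1 - t) *\<^sub>R F x + t *\<^sub>R p)"
  have interior: "H (t, x) \<in> interior T" if "0 < t" "t \<le> 1" "x \<in> cball 0 1" for t x
  proof -
    have "F x - t *\<^sub>R (F x - p) \<in> interior T"
      using assms(2) p that F(2) by (intro mem_interior_convex_shrink) auto
    then show ?thesis by (simp add: H_def algebra_simps)
  qed
  have H0: "H (0, x) = F x" for x by (simp add: H_def)
  have "polynomial_over_C0 (\<lambda>z. H z $ i)" for i
  proof -
    have "real_polynomial_function (\<lambda>x. F x $ i)"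
      using F(1) bounded_linear_vec_nth[of i] by (auto simp: polynomial_function_def o_def)
    then have "polynomial_over_C0 (\<lambda>(t, x). (1 - t) * (F x $ i))"
      by (intro polynomial_over_C0_scaled_polynomial continuous_intros)
    moreover have "polynomial_over_C0 (\<lambda>(t, x::real ^ 'm). t * (p $ i))"
      by (intro polynomial_over_C0_scaled_polynomial real_polynomial_function.intros(2)
          continuous_intros)
    ultimately have "polynomial_over_C0 (\<lambda>z. (case z of (t, x) \<Rightarrow> (1 - t) * (F x $ i))
        + (case z of (t, x::real ^ 'm) \<Rightarrow> t * (p $ i)))"
      by (rule polynomial_over_C0_add)
    then show ?thesis by (simp add: H_def case_prod_unfold)
  qed
  moreover have "continuous_on ({0..1} \<times> cball 0 1) H"
  proof -
    have "continuous_on ({0..1::real} \<times> cball 0 1) (\<lambda>z. F (snd z))"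
      using continuous_on_compose2[OF continuous_on_polymonial_function[OF F(1), of UNIV]
          continuous_on_snd[OF continuous_on_id]] by simp
    then show ?thesis unfolding H_def case_prod_unfold by (intro continuous_intros)
  qed
  moreover have "H ` ({0..1} \<times> cball 0 1) \<subseteq> T"
  proof (clarsimp)
    fix t :: real and x :: "real ^ 'm" assume "0 \<le> t" "t \<le> 1" "norm x \<le> 1"
    then show "H (t, x) \<in> T"
      using interior[of t x] interior_subset[of T] F(2) H0[of x] by (cases "t = 0") auto
  qed
  moreover have "H ` ({0} \<times> cball 0 1) = T"
  proof -
    have "{0::real} \<times> cball (0 :: real ^ 'm) 1 = Pair 0 ` cball 0 1" by auto
    then show ?thesis using F(2) by (simp add: image_image H0)
  qed
  moreover have "(\<lambda>x. H (1, x)) constant_on cball 0 1" by (auto simp: constant_on_def H_def)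
  moreover have "\<forall>t\<in>{0<..<1}. H ` ({t} \<times> cball 0 1) \<subseteq> interior T"
    using interior by (auto simp del: mem_cball)
  moreover have "semialgebraic_dim T = enat CARD('n)"
    using semialgebraic_dim_convex[OF assms(2,3)] by simp
  ultimately show ?thesis
    unfolding brick_def using assms(1) by (intro conjI exI[of _ H]) simp_all
qed

section \<open>The parabolic segment\<close>

lemma parabolic_segment_eq_Int:
  "parabolic_segment a = {v. (v $ 2)\<^sup>2 \<le> v $ 1} \<inter> {v. v $ 1 \<le> sqrt a * v $ 2}"
  by (auto simp: parabolic_segment_def)

lemma semialgebraic_parabolic_segment: "semialgebraic (parabolic_segment a)"
proof -
  have coord: "real_polynomial_function (\<lambda>v :: real ^ 2. v $ i)" for i
    by (intro real_polynomial_function.intros(1) bounded_linear_vec_nth)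
  have "real_polynomial_function (\<lambda>v :: real ^ 2. (v $ 2)\<^sup>2 - v $ 1)"
    "real_polynomial_function (\<lambda>v :: real ^ 2. v $ 1 - sqrt a * v $ 2)"
    by (intro real_polynomial_function_diff real_polynomial_function_power
        real_polynomial_function.intros(4) real_polynomial_function.intros(2) coord)+
  then have "semialgebraic (- {v :: real ^ 2. (v $ 2)\<^sup>2 - v $ 1 > 0}
      \<inter> - {v :: real ^ 2. v $ 1 - sqrt a * v $ 2 > 0})"
    by (intro semialgebraic.intros)
  also have "- {v :: real ^ 2. (v $ 2)\<^sup>2 - v $ 1 > 0} \<inter> - {v. v $ 1 - sqrt a * v $ 2 > 0}
      = parabolic_segment a"
    by (auto simp: parabolic_segment_def)
  finally show ?thesis .
qed

lemma convex_parabolic_segment: "convex (parabolic_segment a)"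
proof -
  have "convex {v :: real ^ 2. (v $ 2)\<^sup>2 \<le> v $ 1}"
  proof (rule convexI, clarsimp)
    fix v w :: "real ^ 2" and s t :: real
    assume *: "(v $ 2)\<^sup>2 \<le> v $ 1" "(w $ 2)\<^sup>2 \<le> w $ 1" "0 \<le> s" "0 \<le> t" "s + t = 1"
    have "(s * v $ 2 + t * w $ 2)\<^sup>2 \<le> s * (v $ 2)\<^sup>2 + t * (w $ 2)\<^sup>2"
    proof -
      have "s = 1 - t" using *(5) by simp
      then show ?thesis using convex_onD[OF convex_power2, of t "v $ 2" "w $ 2"] *(3,4) by simp
    qed
    also have "\<dots> \<le> s * v $ 1 + t * w $ 1" using * by (intro add_mono mult_left_mono)
    finally show "(s * v $ 2 + t * w $ 2)\<^sup>2 \<le> s * v $ 1 + t * w $ 1" .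
  qed
  moreover have "{v :: real ^ 2. v $ 1 \<le> sqrt a * v $ 2} = {v. vector [1, - sqrt a] \<bullet> v \<le> 0}"
    by (auto simp: inner_vec_def sum_2)
  ultimately show ?thesis
    unfolding parabolic_segment_eq_Int by (simp add: convex_Int convex_halfspace_le)
qed

lemma interior_parabolic_segment_nonempty:
  assumes "a > 0"
  shows "interior (parabolic_segment a) \<noteq> {}"
proof -
  let ?U = "{v :: real ^ 2. (v $ 2)\<^sup>2 < v $ 1} \<inter> {v. v $ 1 < sqrt a * v $ 2}"
  have "open ?U" by (intro open_Int open_Collect_less continuous_intros)
  moreover have "?U \<subseteq> parabolic_segment a" by (auto simp: parabolic_segment_def)
  \<comment> \<open>At half the height of the segment, \<open>x\<close> ranges from \<open>a / 4\<close> to \<open>a / 2\<close>; this is the midpoint.\<close>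
  moreover have "vector [3 * a / 8, sqrt a / 2] \<in> ?U"
    using assms by (simp add: power_divide)
  ultimately show ?thesis using interior_maximal by blast
qed

text \<open>With \<open>(x, y) = F (u, v)\<close> one has \<open>x - y\<^sup>2 = a v\<^sup>2 / 4\<close>, which is nonnegative, and
  \<open>\<surd>a y - x = a (1 - u\<^sup>2 - v\<^sup>2) / 4\<close>. The two inequalities of the segment thus say that \<open>v\<close> can be
  solved for and that \<open>(u, v)\<close> lies in the disc.\<close>
lemma parabolic_segment_polynomial_image_of_disc:
  fixes F :: "real ^ 2 \<Rightarrow> real ^ 2"
  assumes "a > 0"
    and F: "F = (\<lambda>v. vector [a / 4 * ((1 + v $ 1)\<^sup>2 + (v $ 2)\<^sup>2), sqrt a / 2 * (1 + v $ 1)])"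
  shows "F ` cball 0 1 = parabolic_segment a"
proof
  have norm: "norm v \<le> 1 \<longleftrightarrow> (v $ 1)\<^sup>2 + (v $ 2)\<^sup>2 \<le> 1" for v :: "real ^ 2"
    by (simp add: norm_vec_def L2_set_def sum_2)
  show "F ` cball 0 1 \<subseteq> parabolic_segment a"
  proof clarsimp
    fix v :: "real ^ 2" assume "norm v \<le> 1"
    then have "(1 + v $ 1)\<^sup>2 + (v $ 2)\<^sup>2 \<le> 2 * (1 + v $ 1)"
      by (simp add: norm power2_eq_square algebra_simps)
    then have "a / 4 * ((1 + v $ 1)\<^sup>2 + (v $ 2)\<^sup>2) \<le> a / 4 * (2 * (1 + v $ 1))"
      using assms(1) by (intro mult_left_mono) auto
    moreover have "sqrt a * (sqrt a / 2 * (1 + v $ 1)) = a / 4 * (2 * (1 + v $ 1))"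
      using assms(1) by (simp flip: mult.assoc)
    moreover have "(sqrt a / 2 * (1 + v $ 1))\<^sup>2 = a / 4 * (1 + v $ 1)\<^sup>2"
      using assms(1) by (simp add: power_mult_distrib power_divide)
    moreover have "a / 4 * (1 + v $ 1)\<^sup>2 \<le> a / 4 * ((1 + v $ 1)\<^sup>2 + (v $ 2)\<^sup>2)"
      using assms(1) by (intro mult_left_mono) auto
    ultimately show "F v \<in> parabolic_segment a"
      unfolding parabolic_segment_def F by simp
  qed
  show "parabolic_segment a \<subseteq> F ` cball 0 1"
  proof
    fix w :: "real ^ 2" assume "w \<in> parabolic_segment a"
    then have w: "(w $ 2)\<^sup>2 \<le> w $ 1" "w $ 1 \<le> sqrt a * w $ 2"
      by (auto simp: parabolic_segment_def)
    define v :: "real ^ 2"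
      where "v = vector [2 * w $ 2 / sqrt a - 1, 2 * sqrt ((w $ 1 - (w $ 2)\<^sup>2) / a)]"
    have v2: "(v $ 2)\<^sup>2 = 4 * (w $ 1 - (w $ 2)\<^sup>2) / a"
      using w assms(1) by (simp add: v_def power_mult_distrib)
    have v1: "1 + v $ 1 = 2 * w $ 2 / sqrt a" by (simp add: v_def)
    then have v1': "(1 + v $ 1)\<^sup>2 = 4 * (w $ 2)\<^sup>2 / a"
      using assms(1) by (simp add: power_divide power_mult_distrib)
    have "F v = w"
      unfolding vec_eq_iff forall_2 using assms(1) v1 v1' v2 by (simp add: F field_simps)
    moreover have "v \<in> cball 0 1"
    proof -
      have "(1 + v $ 1)\<^sup>2 + (v $ 2)\<^sup>2 = 4 * w $ 1 / a"
        unfolding v1' v2 by (simp add: diff_divide_distrib)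
      also have "\<dots> \<le> 4 * (sqrt a * w $ 2) / a"
        using w(2) assms(1) by (intro divide_right_mono) auto
      also have "\<dots> = 2 * (1 + v $ 1)"
        unfolding v1 using assms(1) by (simp add: field_simps)
      finally show ?thesis by (simp add: norm power2_eq_square algebra_simps)
    qed
    ultimately show "w \<in> F ` cball 0 1" by blast
  qed
qed

theorem lemma2p22:
  fixes a :: real
  assumes "a > 0"
  shows "brick TYPE(2) (parabolic_segment a)"
proof -
  define F :: "real ^ 2 \<Rightarrow> real ^ 2"
    where "F = (\<lambda>v. vector [a / 4 * ((1 + v $ 1)\<^sup>2 + (v $ 2)\<^sup>2), sqrt a / 2 * (1 + v $ 1)])"
  have coord: "real_polynomial_function (\<lambda>v :: real ^ 2. v $ i)" for i
    by (intro real_polynomial_function.intros(1) bounded_linear_vec_nth)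
  have "real_polynomial_function (\<lambda>v. F v $ i)" for i
    using exhaust_2[of i] unfolding F_def
    by (auto intro!: real_polynomial_function.intros(2-4) real_polynomial_function_power coord)
  then have "polynomial_function F"
    by (auto simp: polynomial_function_iff_Basis_inner Basis_vec_def inner_axis)
  then show ?thesis
    using brick_convex_polynomial_image[OF semialgebraic_parabolic_segment
        convex_parabolic_segment interior_parabolic_segment_nonempty[OF assms]]
      parabolic_segment_polynomial_image_of_disc[OF assms F_def] by blast
qed

end
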